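(* Let $q$ be a prime power such that $q=3^h$ for some integer $h\geq 1$, or $q\equiv 1\pmod 4$. Consider an elliptic quadric $Q^-(3,q)$ in its ambient projective space $\mathrm{PG}(3,q)$. Then there exists a line spread of $\mathrm{PG}(3,q)$ containing exactly $|Q^-(3,q)|/2=(q^2+1)/2$ lines that are $2$-secant to $Q^-(3,q)$.
   Context: $Q^-(3,q)$ is the set of points of $\mathrm{PG}(3,q)$ that are zeros of a non-singular quadratic form on $\mathbb{F}_q^4$ of Witt index $1$, e.g. $X_0X_1+g(X_2,X_3)$ with $g$ an irreducible binary quadratic form; it has $q^2+1$ points. A line spread of $\mathrm{PG}(3,q)$ is a set of $q^2+1$ lines such that every point of $\mathrm{PG}(3,q)$ lies on exactly one of them. A line is $2$-secant to a point set if it has exactly two points in common with it. *)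

theory Defs
  imports "HOL-Analysis.Analysis" "HOL-Number_Theory.Number_Theory"
begin

text \<open>
  The projective space PG(3,q) is that of the vector space \<open>'a ^ 4\<close>, where \<open>'a\<close> is a
  finite field with q elements: points and lines are the vector subspaces of (vector)
  dimension 1 and 2, and incidence is inclusion.
\<close>

definition pg_points :: "('a::field ^ 4) set set" where
  "pg_points = {P. vec.subspace P \<and> vec.dim P = 1}"

definition pg_lines :: "('a::field ^ 4) set set" where
  "pg_lines = {L. vec.subspace L \<and> vec.dim L = 2}"

definition line_spread :: "('a::{field,finite} ^ 4) set set \<Rightarrow> bool" where
  "line_spread S \<longleftrightarrow>
     S \<subseteq> pg_lines \<and> card S = CARD('a)\<^sup>2 + 1 \<and> (\<forall>P\<in>pg_points. \<exists>!L. L \<in> S \<and> P \<subseteq> L)"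

text \<open>
  A quadratic form is (the function of) a homogeneous quadratic polynomial in the coordinates.
  The coefficient matrix need not be symmetric, so this is correct in every characteristic.
\<close>

definition quadratic_form :: "('a::field ^ 'n \<Rightarrow> 'a) \<Rightarrow> bool" where
  "quadratic_form Q \<longleftrightarrow>
     (\<exists>A :: 'a ^ 'n ^ 'n. \<forall>x. Q x = (\<Sum>i\<in>UNIV. \<Sum>j\<in>UNIV. A $ i $ j * x $ i * x $ j))"

definition polar_form :: "('a::field ^ 'n \<Rightarrow> 'a) \<Rightarrow> 'a ^ 'n \<Rightarrow> 'a ^ 'n \<Rightarrow> 'a" where
  "polar_form Q x y = Q (x + y) - Q x - Q y"

text \<open>
  Non-singularity: no nonzero singular vector lies in the radical of the polar form.  In odd
  characteristic \<open>Q x = 0\<close> is implied by the second condition, as \<open>polar_form Q x x = 2 * Q x\<close>.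
\<close>

definition nonsingular_form :: "('a::field ^ 'n \<Rightarrow> 'a) \<Rightarrow> bool" where
  "nonsingular_form Q \<longleftrightarrow> (\<forall>x. Q x = 0 \<and> (\<forall>y. polar_form Q x y = 0) \<longrightarrow> x = 0)"

definition totally_singular :: "('a::field ^ 'n \<Rightarrow> 'a) \<Rightarrow> ('a ^ 'n) set \<Rightarrow> bool" where
  "totally_singular Q W \<longleftrightarrow> vec.subspace W \<and> (\<forall>x\<in>W. Q x = 0)"

definition witt_index :: "('a::field ^ 'n \<Rightarrow> 'a) \<Rightarrow> nat" where
  "witt_index Q = Max {vec.dim W | W. totally_singular Q W}"

definition quadric :: "('a::field ^ 4 \<Rightarrow> 'a) \<Rightarrow> ('a ^ 4) set set" where
  "quadric Q = {P \<in> pg_points. \<forall>x\<in>P. Q x = 0}"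

definition elliptic_quadric :: "('a::field ^ 4) set set \<Rightarrow> bool" where
  "elliptic_quadric E \<longleftrightarrow>
     (\<exists>Q. quadratic_form Q \<and> nonsingular_form Q \<and> witt_index Q = 1 \<and> E = quadric Q)"

definition two_secant :: "('a::field ^ 4) set \<Rightarrow> ('a ^ 4) set set \<Rightarrow> bool" where
  "two_secant L E \<longleftrightarrow> L \<in> pg_lines \<and> card {P \<in> E. P \<subseteq> L} = 2"

end

theory Submission
  imports Defs
begin

text \<open>
  Let T be a linear map with \<open>T\<^sup>2 = n\<close> for a nonsquare n and \<open>Q (T v) = n * Q v\<close>.  The lines
  \<open>\<langle>v, T v\<rangle>\<close> are the points of the projective line over \<open>F\<^sub>q(\<surd>n)\<close>, hence form a regular spread.
  If \<open>\<langle>v, T v\<rangle>\<close> meets the quadric in \<open>\<langle>v\<rangle>\<close>, it meets it in \<open>\<langle>T v\<rangle>\<close> as well, and nowhere else because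
  Q has Witt index 1.  So no spread line is tangent, and the 2-secant ones partition the quadric into
  pairs.  Writing Q as \<open>x\<^sub>0 x\<^sub>1 + a x\<^sub>2\<^sup>2 + c x\<^sub>3\<^sup>2\<close>, such a T is
  \<open>(x\<^sub>0, x\<^sub>1, x\<^sub>2, x\<^sub>3) \<mapsto> (n x\<^sub>1, x\<^sub>0, p x\<^sub>2 + c t x\<^sub>3, a t x\<^sub>2 - p x\<^sub>3)\<close>
  where p and t are chosen so that \<open>n = p\<^sup>2 + a c t\<^sup>2\<close> is a nonsquare.
\<close>

section \<open>Finite fields: odd characteristic and nonsquare values of a binary form\<close>

lemma two_neq_zero_if_odd_CARD:
  assumes "odd CARD('a::{field,finite})"
  shows "(2::'a) \<noteq> 0"
proof
  assume "(2::'a) = 0"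
  then have "of_nat 2 = (0::'a)"
    by simp
  then have "CHAR('a) dvd 2"
    by (simp only: of_nat_eq_0_iff_char_dvd)
  then have "CHAR('a) = 1 \<or> CHAR('a) = 2"
    using two_is_prime_nat by (metis prime_nat_iff)
  then have "CHAR('a) = 2"
    using CHAR_not_1[where 'a='a] by simp
  with CHAR_dvd_CARD[where 'a='a] assms show False
    by simp
qed

text \<open>
  If all values were squares, then d would be a square and sums of squares would be squares, so
  \<open>- 1\<close>, being \<open>CHAR('a) - 1\<close> times 1, and hence \<open>- d\<close> would be squares.
\<close>

lemma nonsquare_value_exists:
  fixes d :: "'a::{field,finite}"
  assumes d: "\<And>s. s\<^sup>2 \<noteq> - d"
  obtains p t where "\<And>s. s\<^sup>2 \<noteq> p\<^sup>2 + d * t\<^sup>2"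
proof (rule ccontr)
  assume "\<not> thesis"
  with that have sq: "\<exists>s. s\<^sup>2 = p\<^sup>2 + d * t\<^sup>2" for p t
    by blast
  from sq[of 0 1] obtain r where r: "r\<^sup>2 = d"
    by auto
  have "r \<noteq> 0"
    using d[of 0] r by auto
  have add: "\<exists>s. s\<^sup>2 = u\<^sup>2 + v\<^sup>2" for u v :: 'a
    using sq[of u "v / r"] r \<open>r \<noteq> 0\<close> by (auto simp: power_divide)
  have nat: "\<exists>s::'a. s\<^sup>2 = of_nat k" for k
  proof (induction k)
    case 0
    show ?case by (intro exI[of _ 0]) simp
  next
    case (Suc k)
    then obtain s :: 'a where "s\<^sup>2 = of_nat k"
      by blast
    with add[of 1 s] show ?case
      by simp
  qed
  have "CHAR('a) > 0"
    by (simp add: finite_imp_CHAR_pos)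
  then have "of_nat (CHAR('a) - 1) = (- 1 :: 'a)"
    by (simp add: of_nat_diff)
  with nat[of "CHAR('a) - 1"] obtain i :: 'a where "i\<^sup>2 = - 1"
    by auto
  with d[of "i * r"] r show False
    by (simp add: power_mult_distrib)
qed

section \<open>Spans of one, two and three vectors\<close>

lemma in_span_pair_iff:
  fixes x y z :: "'a::field ^ 'n"
  shows "z \<in> vec.span {x, y} \<longleftrightarrow> (\<exists>\<alpha> \<beta>. z = \<alpha> *s x + \<beta> *s y)"
proof -
  have "z - k *s x = l *s y \<longleftrightarrow> z = k *s x + l *s y" for k l
    by (auto simp: algebra_simps)
  then show ?thesis
    unfolding vec.span_breakdown_eq[of z x] vec.span_singleton by auto
qed

lemma not_in_span_singleton_independent:
  fixes x y :: "'a::field ^ 'n"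
  assumes "y \<notin> vec.span {x}" "\<alpha> *s x + \<beta> *s y = 0" "x \<noteq> 0"
  shows "\<alpha> = 0 \<and> \<beta> = 0"
proof -
  have "\<beta> = 0"
  proof (rule ccontr)
    assume "\<beta> \<noteq> 0"
    have "\<beta> *s y = (- \<alpha>) *s x"
      using assms(2) by (simp add: eq_neg_iff_add_eq_0 add.commute)
    then have "inverse \<beta> *s (\<beta> *s y) = (inverse \<beta> * (- \<alpha>)) *s x"
      by simp
    then have "y = (inverse \<beta> * (- \<alpha>)) *s x"
      using \<open>\<beta> \<noteq> 0\<close> by simp
    with assms(1) show False
      unfolding vec.span_singleton by blast
  qed
  with assms show ?thesis
    by simp
qed

lemma dim_span_pair:
  fixes x y :: "'a::field ^ 'n"
  assumes "x \<noteq> 0" "y \<notin> vec.span {x}"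
  shows "vec.dim (vec.span {x, y}) = 2"
proof -
  have "vec.dim (insert y {x}) = 2"
    using assms by (subst vec.dim_insert) auto
  then show ?thesis
    by (simp add: insert_commute)
qed

lemma pg_points_iff: "P \<in> pg_points \<longleftrightarrow> (\<exists>v. v \<noteq> 0 \<and> P = vec.span {v})"
proof
  assume "P \<in> pg_points"
  then have P: "vec.subspace P" "vec.dim P = 1"
    by (auto simp: pg_points_def)
  then obtain v where v: "v \<in> P" "v \<noteq> 0"
    using vec.dim_eq_0[of P] by fastforce
  have "vec.span {v} = P"
    using v P by (intro vec.subspace_dim_equal vec.span_minimal) auto
  with v show "\<exists>v. v \<noteq> 0 \<and> P = vec.span {v}"
    by blast
qed (auto simp: pg_points_def)

lemma span_singleton_subset_iff:
  fixes v :: "'a::field ^ 'n"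
  assumes "vec.subspace L"
  shows "vec.span {v} \<subseteq> L \<longleftrightarrow> v \<in> L"
  using assms vec.span_minimal[of "{v}" L] vec.span_base[of v "{v}"] by auto

lemma span_singleton_eqD:
  fixes v w :: "'a::field ^ 'n"
  assumes "vec.span {v} = vec.span {w}"
  obtains k where "v = k *s w"
proof -
  have "v \<in> vec.span {v}"
    by (simp add: vec.span_base)
  then have "v \<in> vec.span {w}"
    by (simp only: assms)
  with that show ?thesis
    by (auto simp: vec.span_singleton)
qed

lemma span_singleton_eqI:
  fixes v w :: "'a::field ^ 'n"
  assumes "v = k *s w" "k \<noteq> 0"
  shows "vec.span {v} = vec.span {w}"
proof -
  have "w = inverse k *s v"
    using assms by simp
  then show ?thesis
    using assms(1) by (intro vec.span_eq[THEN iffD2]) (auto simp: vec.span_singleton)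
qed

lemma card_span_pair:
  fixes x y :: "'a::{field,finite} ^ 'n"
  assumes "x \<noteq> 0" "y \<notin> vec.span {x}"
  shows "card (vec.span {x, y}) = CARD('a)\<^sup>2"
proof -
  let ?f = "\<lambda>(\<alpha>, \<beta>). \<alpha> *s x + \<beta> *s y"
  have "inj ?f"
  proof (rule injI, clarify)
    fix a b a' b'
    assume "a *s x + b *s y = a' *s x + b' *s y"
    then have "(a - a') *s x + (b - b') *s y = 0"
      by (simp add: vector_sub_rdistrib algebra_simps)
    then have "a - a' = 0 \<and> b - b' = 0"
      by (rule not_in_span_singleton_independent[OF assms(2) _ assms(1)])
    then show "a = a' \<and> b = b'"
      by simp
  qed
  moreover have "vec.span {x, y} = range ?f"
    by (auto simp: in_span_pair_iff set_eq_iff image_iff)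
  ultimately show ?thesis
    by (simp add: card_image power2_eq_square)
qed

text \<open>Three vectors span at most a hyperplane. They need not be distinct, so repeating one of
  them gives a vector outside the span of two.\<close>

lemma vector_outside_span:
  fixes x y z :: "'a::field ^ 4"
  obtains v where "v \<notin> vec.span {x, y, z}"
proof -
  have "vec.dim {x, y, z} \<le> card {x, y, z}"
    by (intro vec.dim_le_card) (auto simp: vec.span_superset)
  also have "\<dots> \<le> 3"
    by (simp add: card_insert_if)
  finally have "vec.dim (vec.span {x, y, z}) \<le> 3"
    by simp
  moreover have "vec.dim (UNIV :: ('a ^ 4) set) = 4"
    by (simp only: vec_dim_card) simp
  ultimately have "vec.span {x, y, z} \<noteq> UNIV"
    by force
  with that show ?thesis
    by blast
qed

section \<open>The regular spread of a linear map that squares to a nonsquare scalar\<close>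

locale nonsquare_operator =
  fixes T :: "'a::{field,finite} ^ 4 \<Rightarrow> 'a ^ 4" and n :: 'a
  assumes T_add: "T (x + y) = T x + T y"
    and T_scale: "T (k *s x) = k *s T x"
    and T_T: "T (T x) = n *s x"
    and nonsquare: "s\<^sup>2 \<noteq> n"
begin

definition line :: "'a ^ 4 \<Rightarrow> ('a ^ 4) set" where
  "line v = vec.span {v, T v}"

definition spread :: "('a ^ 4) set set" where
  "spread = line ` (UNIV - {0})"

text \<open>An eigenvalue k of \<open>T\<close> would satisfy \<open>k\<^sup>2 = n\<close>, so
  \<open>T\<close> fixes no point.\<close>

lemma T_notin_span: "v \<noteq> 0 \<Longrightarrow> T v \<notin> vec.span {v}"
proof
  assume v: "v \<noteq> 0" "T v \<in> vec.span {v}"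
  then obtain k where k: "T v = k *s v"
    by (auto simp: vec.span_singleton)
  then have "k\<^sup>2 *s v = n *s v"
    by (metis T_T T_scale vector_smult_assoc power2_eq_square)
  with v nonsquare[of k] show False
    unfolding vec.scale_cancel_right by blast
qed

lemma line_in_pg_lines: "v \<noteq> 0 \<Longrightarrow> line v \<in> pg_lines"
  by (simp add: pg_lines_def line_def dim_span_pair T_notin_span del: vec.dim_span)

lemma card_line: "v \<noteq> 0 \<Longrightarrow> card (line v) = CARD('a)\<^sup>2"
  by (simp add: line_def card_span_pair T_notin_span)

lemma subspace_line: "vec.subspace (line v)"
  by (simp add: line_def)

lemma in_line: "v \<in> line v" "T v \<in> line v"
  by (auto simp: line_def vec.span_base)

text \<open>Since \<open>T\<^sup>2\<close> is a scalar, \<open>line v\<close> is invariant under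
  \<open>T\<close>. It therefore contains \<open>line w\<close>, and the dimensions agree. This
  makes distinct spread lines meet only in 0.\<close>

lemma line_eqI:
  assumes "w \<in> line v" "w \<noteq> 0"
  shows "line w = line v"
proof -
  obtain \<alpha> \<beta> where w: "w = \<alpha> *s v + \<beta> *s T v"
    using assms(1) by (auto simp: line_def in_span_pair_iff)
  with assms(2) have "v \<noteq> 0"
    using T_scale[of 0 v] by auto
  have "T w = (\<beta> * n) *s v + \<alpha> *s T v"
    by (simp add: w T_add T_scale T_T add.commute)
  then have "T w \<in> line v"
    by (auto simp: line_def in_span_pair_iff)
  with assms(1) have "line w \<subseteq> line v"
    unfolding line_def[of w] by (intro vec.span_minimal) (auto simp: subspace_line)
  with \<open>v \<noteq> 0\<close> \<open>w \<noteq> 0\<close> show ?thesis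
    using line_in_pg_lines by (intro vec.subspace_dim_equal) (auto simp: pg_lines_def)
qed

lemma in_spread_eq_line: "L \<in> spread \<Longrightarrow> w \<in> L \<Longrightarrow> w \<noteq> 0 \<Longrightarrow> L = line w"
  using line_eqI by (auto simp: spread_def)

lemma ex1_spread_line:
  assumes "P \<in> pg_points"
  shows "\<exists>!L. L \<in> spread \<and> P \<subseteq> L"
proof -
  obtain v where v: "v \<noteq> 0" "P = vec.span {v}"
    using assms by (auto simp: pg_points_iff)
  show ?thesis
  proof (rule ex1I[of _ "line v"])
    show "line v \<in> spread \<and> P \<subseteq> line v"
      using v by (simp add: spread_def span_singleton_subset_iff subspace_line in_line)
    show "L = line v" if "L \<in> spread \<and> P \<subseteq> L" for L
      using that v in_spread_eq_line[of L v] by (auto simp: vec.span_base subset_iff)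
  qed
qed

text \<open>Double counting of vectors: with 0 removed, the spread lines partition the
  \<open>q^4 - 1\<close> nonzero vectors into blocks of size \<open>q^2 - 1\<close>. Removing 0
  merges no two lines, as 0 lies on all of them.\<close>

lemma card_spread: "card spread = CARD('a)\<^sup>2 + 1"
proof -
  let ?q = "CARD('a)"
  define C where "C = (\<lambda>L. L - {0}) ` spread"
  have "inj_on (\<lambda>L. L - {0}) spread"
    using vec.subspace_0[OF subspace_line] by (intro inj_onI) (auto simp: spread_def)
  then have "card C = card spread"
    by (simp add: C_def card_image)
  have "\<Union> C = UNIV - {0}"
    using in_line(1) by (auto simp: C_def spread_def)
  have "(?q\<^sup>2 - 1) * card C = card (\<Union> C)"
  proof (rule card_partition)
    show "card c = ?q\<^sup>2 - 1" if "c \<in> C" for c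
      using that card_line vec.subspace_0[OF subspace_line]
      by (auto simp: C_def spread_def card_Diff_singleton)
    show "c1 \<inter> c2 = {}" if c: "c1 \<in> C" "c2 \<in> C" "c1 \<noteq> c2" for c1 c2
    proof (rule ccontr)
      assume "c1 \<inter> c2 \<noteq> {}"
      then obtain w where w: "w \<in> c1" "w \<in> c2"
        by auto
      obtain L1 L2 where "c1 = L1 - {0}" "c2 = L2 - {0}" "L1 \<in> spread" "L2 \<in> spread"
        using c by (auto simp: C_def)
      with w in_spread_eq_line[of L1 w] in_spread_eq_line[of L2 w] c(3) show False
        by auto
    qed
  qed simp_all
  also have "\<dots> = ?q ^ 4 - 1"
    by (simp add: \<open>\<Union> C = UNIV - {0}\<close> card_Diff_singleton)
  also have "\<dots> = (?q\<^sup>2 - 1) * (?q\<^sup>2 + 1)"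
    by (simp add: algebra_simps diff_mult_distrib flip: power_add power2_eq_square)
  finally have "(?q\<^sup>2 - 1) * card C = (?q\<^sup>2 - 1) * (?q\<^sup>2 + 1)" .
  moreover have "?q\<^sup>2 - 1 \<noteq> 0"
  proof -
    have "card {0, 1 :: 'a} \<le> ?q"
      by (intro card_mono) auto
    then have "2 \<le> ?q"
      by simp
    then have "2\<^sup>2 \<le> ?q\<^sup>2"
      by (intro power_mono) auto
    then show ?thesis
      by simp
  qed
  ultimately show ?thesis
    using \<open>card C = card spread\<close> mult_left_cancel by metis
qed

lemma line_spread_spread: "line_spread spread"
  using line_in_pg_lines card_spread ex1_spread_line
  by (auto simp: line_spread_def spread_def)

end

section \<open>Quadratic forms of Witt index 1 in odd characteristic\<close>

locale elliptic_form =
  fixes Q :: "'a::{field,finite} ^ 4 \<Rightarrow> 'a"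
  assumes form: "quadratic_form Q"
    and nonsingular: "nonsingular_form Q"
    and witt_index: "witt_index Q = 1"
    and two_neq_0: "(2::'a) \<noteq> 0"
begin

abbreviation b :: "'a ^ 4 \<Rightarrow> 'a ^ 4 \<Rightarrow> 'a" where
  "b \<equiv> polar_form Q"

lemma Q_scale: "Q (k *s x) = k\<^sup>2 * Q x"
  using form by (auto simp: quadratic_form_def sum_distrib_left power2_eq_square algebra_simps
      intro!: sum.cong)

lemma Q_add: "Q (x + y) = Q x + Q y + b x y"
  by (simp add: polar_form_def)

lemma b_commute: "b x y = b y x"
  by (simp add: polar_form_def add.commute)

text \<open>In Q (x + y) the pure terms cancel and only the mixed ones remain. Bilinearity of the
  polar form is read off from this expansion.\<close>

lemma b_eq_sum:
  obtains A :: "'a ^ 4 ^ 4"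
  where "\<And>x y. b x y = (\<Sum>i\<in>UNIV. \<Sum>j\<in>UNIV. A $ i $ j * (x $ i * y $ j + y $ i * x $ j))"
proof -
  obtain A :: "'a ^ 4 ^ 4"
    where "\<And>x. Q x = (\<Sum>i\<in>UNIV. \<Sum>j\<in>UNIV. A $ i $ j * x $ i * x $ j)"
    using form by (auto simp: quadratic_form_def)
  then have "b x y = (\<Sum>i\<in>UNIV. \<Sum>j\<in>UNIV. A $ i $ j * (x $ i * y $ j + y $ i * x $ j))" for x y
    by (simp add: polar_form_def algebra_simps flip: sum_subtractf sum.distrib)
  with that show ?thesis
    by blast
qed

lemma b_add_left: "b (x + y) z = b x z + b y z"
proof -
  obtain A :: "'a ^ 4 ^ 4"
    where "\<And>x y. b x y = (\<Sum>i\<in>UNIV. \<Sum>j\<in>UNIV. A $ i $ j * (x $ i * y $ j + y $ i * x $ j))"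
    by (rule b_eq_sum) blast
  then show ?thesis
    by (simp add: algebra_simps flip: sum.distrib)
qed

lemma b_scale_left: "b (k *s x) z = k * b x z"
proof -
  obtain A :: "'a ^ 4 ^ 4"
    where "\<And>x y. b x y = (\<Sum>i\<in>UNIV. \<Sum>j\<in>UNIV. A $ i $ j * (x $ i * y $ j + y $ i * x $ j))"
    by (rule b_eq_sum) blast
  then show ?thesis
    by (simp add: algebra_simps sum_distrib_left)
qed

lemma b_add_right: "b z (x + y) = b z x + b z y"
  by (simp add: b_commute[of z] b_add_left)

lemma b_scale_right: "b z (k *s x) = k * b z x"
  by (simp add: b_commute[of z] b_scale_left)

lemma b_diff_left: "b (x - y) z = b x z - b y z"
  using b_add_left[of "x - y" y z] by simp

lemma b_self: "b x x = 2 * Q x"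
proof -
  have "x + x = 2 *s x"
    by (simp add: vec_eq_iff)
  then show ?thesis
    by (simp add: polar_form_def Q_scale power2_eq_square algebra_simps)
qed

lemmas b_simps = b_add_left b_add_right b_scale_left b_scale_right b_diff_left b_self

lemma Q_zero: "Q 0 = 0"
  using Q_scale[of 0 0] by simp

lemma in_quadric_iff: "P \<in> quadric Q \<longleftrightarrow> (\<exists>v. v \<noteq> 0 \<and> P = vec.span {v} \<and> Q v = 0)"
proof -
  have "(\<forall>x\<in>vec.span {v}. Q x = 0) \<longleftrightarrow> Q v = 0" for v
    using vec.span_base[of v "{v}"] by (auto simp: vec.span_singleton Q_scale)
  then show ?thesis
    unfolding quadric_def pg_points_iff by auto
qed

text \<open>The maximum in \<open>witt_index\<close> is meaningful only for a finite nonempty set of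
  dimensions.\<close>

lemma dims_totally_singular:
  "finite {vec.dim W | W. totally_singular Q W}" (is "finite ?D")
  "{vec.dim W | W. totally_singular Q W} \<noteq> {}"
proof -
  have "?D \<subseteq> vec.dim ` (UNIV :: ('a ^ 4) set set)"
    by auto
  then show "finite ?D"
    by (rule finite_subset) simp
  have "totally_singular Q {0}"
    by (simp add: totally_singular_def Q_zero)
  then show "?D \<noteq> {}"
    by blast
qed

lemma singular_vector_exists:
  obtains e where "e \<noteq> 0" "Q e = 0"
proof -
  have "1 \<in> {vec.dim W | W. totally_singular Q W}"
    using Max_in[OF dims_totally_singular] witt_index by (simp add: witt_index_def)
  then obtain W where W: "vec.dim W = 1" "totally_singular Q W"
    by auto
  then obtain e where "e \<in> W" "e \<noteq> 0"
    using vec.dim_eq_0[of W] by fastforce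
  with W that show ?thesis
    by (auto simp: totally_singular_def)
qed

text \<open>Otherwise x and y would span a totally singular subspace of dimension 2, against Witt
  index 1. This is the form in which the upper bound on the Witt index is used.\<close>

lemma orthogonal_singular_in_span:
  assumes "Q x = 0" "Q y = 0" "b x y = 0" "x \<noteq> 0"
  shows "y \<in> vec.span {x}"
proof (rule ccontr)
  assume "y \<notin> vec.span {x}"
  then have "vec.dim (vec.span {x, y}) = 2"
    using assms(4) by (rule dim_span_pair[rotated])
  moreover have "totally_singular Q (vec.span {x, y})"
    using assms by (auto simp: totally_singular_def in_span_pair_iff Q_add Q_scale b_simps)
  ultimately have "2 \<in> {vec.dim W | W. totally_singular Q W}"
    by (smt (verit) mem_Collect_eq)
  then have "2 \<le> witt_index Q"
    unfolding witt_index_def by (intro Max_ge dims_totally_singular)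
  with witt_index show False
    by simp
qed

lemma hyperbolic_pair_exists:
  obtains e f where "Q e = 0" "Q f = 0" "b e f = 1"
proof -
  obtain e where e: "e \<noteq> 0" "Q e = 0"
    by (rule singular_vector_exists)
  then obtain y where "b e y \<noteq> 0"
    using nonsingular by (auto simp: nonsingular_form_def)
  define z where "z = inverse (b e y) *s y"
  have z: "b e z = 1"
    using \<open>b e y \<noteq> 0\<close> by (simp add: z_def b_simps)
  \<comment> \<open>As Q e = 0 and b z e = 1, adding k times e to z changes Q z to Q z + k and
    leaves the product with e unchanged; k = - Q z makes the vector singular.\<close>
  define f where "f = z + (- Q z) *s e"
  have "Q f = 0"
    by (simp only: f_def Q_add Q_scale b_simps e z b_commute[of z e]) simp
  moreover have "b e f = 1"
    by (simp only: f_def b_simps e z) simp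
  ultimately show ?thesis
    using that e by blast
qed

text \<open>A singular y orthogonal to e is a multiple of e, and its product with f is the
  coefficient. Hence Q is anisotropic on the orthogonal complement of a hyperbolic pair.\<close>

lemma orthogonal_to_hyperbolic_pair_anisotropic:
  assumes "Q e = 0" "b e f = 1" "b e y = 0" "b f y = 0" "Q y = 0"
  shows "y = 0"
proof -
  have "e \<noteq> 0"
    using assms b_scale_left[of 0 e f] by auto
  then have "y \<in> vec.span {e}"
    using assms by (intro orthogonal_singular_in_span) auto
  then obtain k where "y = k *s e"
    by (auto simp: vec.span_singleton)
  with assms show ?thesis
    by (simp add: b_simps b_commute[of f e])
qed

end

section \<open>Coordinates in which the form is a hyperbolic plane plus a diagonal anisotropic
  plane\<close>

locale elliptic_frame = elliptic_form +
  fixes e f g h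
  assumes Q_e: "Q e = 0" and Q_f: "Q f = 0" and b_e_f: "b e f = 1"
    and b_e_g: "b e g = 0" and b_f_g: "b f g = 0"
    and b_e_h: "b e h = 0" and b_f_h: "b f h = 0" and b_g_h: "b g h = 0"
    and g_neq_0: "g \<noteq> 0" and h_neq_0: "h \<noteq> 0"

text \<open>Gram-Schmidt: a hyperbolic pair is extended twice by a vector outside the current span,
  made orthogonal to the vectors already chosen.\<close>

lemma (in elliptic_form) elliptic_frame_exists:
  obtains e f g h where "elliptic_frame Q e f g h"
proof -
  obtain e f where ef: "Q e = 0" "Q f = 0" "b e f = 1"
    by (rule hyperbolic_pair_exists)
  note b_ef = ef(3) trans[OF b_commute ef(3)]
  have self: "b e e = 0" "b f f = 0"
    by (simp_all add: b_self ef)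
  obtain v where v: "v \<notin> vec.span {e, f, f}"
    by (rule vector_outside_span)
  \<comment> \<open>For a hyperbolic pair the coefficient along e is the product with f, and vice
    versa.\<close>
  define g where "g = v - (b v f *s e + b v e *s f)"
  have "b v f *s e + b v e *s f \<in> vec.span {e, f, f}"
    by (intro vec.span_add vec.span_scale vec.span_base) auto
  with v have "g \<noteq> 0"
    by (auto simp: g_def)
  have "b g e = 0" "b g f = 0"
    by (simp_all only: g_def b_diff_left b_add_left b_scale_left b_ef self) simp_all
  then have g: "b e g = 0" "b f g = 0"
    by (simp_all add: b_commute)
  have "Q g \<noteq> 0"
    using orthogonal_to_hyperbolic_pair_anisotropic[of e f g] ef g \<open>g \<noteq> 0\<close> by blast
  obtain w where w: "w \<notin> vec.span {e, f, g}"
    by (rule vector_outside_span)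
  \<comment> \<open>The divisor is b g g = 2 * Q g, nonzero by anisotropy and odd
    characteristic.\<close>
  define h where "h = w - (b w f *s e + b w e *s f + (b w g / (2 * Q g)) *s g)"
  have "b w f *s e + b w e *s f + (b w g / (2 * Q g)) *s g \<in> vec.span {e, f, g}"
    by (intro vec.span_add vec.span_scale vec.span_base) auto
  with w have "h \<noteq> 0"
    by (auto simp: h_def)
  have "b h e = 0" "b h f = 0" "b h g = 0"
    using \<open>b g e = 0\<close> \<open>b g f = 0\<close> \<open>Q g \<noteq> 0\<close> two_neq_0 g
    by (simp_all add: h_def b_diff_left b_add_left b_scale_left b_ef self b_self ef)
  then have "b e h = 0" "b f h = 0" "b g h = 0"
    by (simp_all add: b_commute)
  then have "elliptic_frame Q e f g h"
    using ef g \<open>g \<noteq> 0\<close> \<open>h \<noteq> 0\<close> by unfold_locales auto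
  with that show ?thesis
    by blast
qed

context elliptic_frame
begin

definition comb :: "'a \<Rightarrow> 'a \<Rightarrow> 'a \<Rightarrow> 'a \<Rightarrow> 'a ^ 4" where
  "comb x0 x1 x2 x3 = x0 *s e + x1 *s f + x2 *s g + x3 *s h"

lemmas b_frame =
  b_e_f b_e_g b_f_g b_e_h b_f_h b_g_h
  b_e_f[unfolded b_commute[of e]] b_e_g[unfolded b_commute[of e]] b_f_g[unfolded b_commute[of f]]
  b_e_h[unfolded b_commute[of e]] b_f_h[unfolded b_commute[of f]] b_g_h[unfolded b_commute[of g]]

lemma Q_g: "Q g \<noteq> 0" and Q_h: "Q h \<noteq> 0"
  using orthogonal_to_hyperbolic_pair_anisotropic[of e f] Q_e b_frame g_neq_0 h_neq_0 by blast+

lemma Q_comb: "Q (comb x0 x1 x2 x3) = x0 * x1 + x2\<^sup>2 * Q g + x3\<^sup>2 * Q h"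
  by (simp add: comb_def Q_add Q_scale b_simps b_frame Q_e Q_f)

text \<open>Products with the frame recover the coordinates, with e and f exchanging roles. This
  gives their uniqueness and lets \<open>T\<close> be defined without choosing coordinates.\<close>

lemma b_comb:
  "b (comb x0 x1 x2 x3) e = x1" "b (comb x0 x1 x2 x3) f = x0"
  "b (comb x0 x1 x2 x3) g = x2 * (2 * Q g)" "b (comb x0 x1 x2 x3) h = x3 * (2 * Q h)"
  by (simp_all add: comb_def b_simps b_frame Q_e Q_f)

lemma comb_eq_iff:
  "comb x0 x1 x2 x3 = comb y0 y1 y2 y3 \<longleftrightarrow> x0 = y0 \<and> x1 = y1 \<and> x2 = y2 \<and> x3 = y3"
  using b_comb[of x0 x1 x2 x3] b_comb[of y0 y1 y2 y3] Q_g Q_h two_neq_0 by auto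

lemma comb_scale: "k *s comb x0 x1 x2 x3 = comb (k * x0) (k * x1) (k * x2) (k * x3)"
  by (simp add: comb_def vec.scale_right_distrib)

lemma comb_add:
  "comb x0 x1 x2 x3 + comb y0 y1 y2 y3 = comb (x0 + y0) (x1 + y1) (x2 + y2) (x3 + y3)"
  by (simp add: comb_def vec.scale_left_distrib)

lemma comb_zero: "comb 0 0 0 0 = 0"
  by (simp add: comb_def)

text \<open>The coordinate map is an injection of a finite set into itself, hence surjective; no
  dimension argument is involved.\<close>

lemma comb_cases:
  obtains x0 x1 x2 x3 where "v = comb x0 x1 x2 x3"
proof -
  let ?\<phi> = "\<lambda>x :: 'a ^ 4. comb (x $ 1) (x $ 2) (x $ 3) (x $ 4)"
  have "inj ?\<phi>"
    by (rule injI) (unfold comb_eq_iff, simp add: vec_eq_iff forall_4)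
  then have "surj ?\<phi>"
    by (intro finite_UNIV_inj_surj) auto
  then obtain x where "v = ?\<phi> x"
    by (elim surjE)
  with that show ?thesis
    by blast
qed

text \<open>With such an s, the vector s g + (Q g) h would be nonzero and singular in the
  anisotropic plane. This supplies the hypothesis of \<open>nonsquare_value_exists\<close> for d = Q
  g * Q h.\<close>

lemma nonsquare_discriminant: "s\<^sup>2 \<noteq> - (Q g * Q h)"
proof
  assume s: "s\<^sup>2 = - (Q g * Q h)"
  have "Q (comb 0 0 s (Q g)) = 0"
    unfolding Q_comb s by (simp add: power2_eq_square)
  then have "comb 0 0 s (Q g) = 0"
    by (intro orthogonal_to_hyperbolic_pair_anisotropic[of e f])
      (simp_all add: Q_e b_e_f b_comb b_commute[of _ "comb _ _ _ _"])
  then show False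
    using Q_g comb_eq_iff[of 0 0 s "Q g" 0 0 0 0] by (simp add: comb_zero)
qed

lemma card_quadric: "card (quadric Q) = CARD('a)\<^sup>2 + 1"
proof -
  \<comment> \<open>a singular point off the hyperplane \<open>x0 = 0\<close> is determined by its last two coordinates\<close>
  define \<psi> where "\<psi> = (\<lambda>(x, y). vec.span {comb 1 (- (x\<^sup>2 * Q g + y\<^sup>2 * Q h)) x y})"
  have f: "k *s f = comb 0 k 0 0" for k
    by (simp add: comb_def)
  have inj: "inj \<psi>"
  proof (rule injI, clarify)
    fix x y x' y'
    assume "\<psi> (x, y) = \<psi> (x', y')"
    then obtain k where "comb 1 (- (x\<^sup>2 * Q g + y\<^sup>2 * Q h)) x y
        = k *s comb 1 (- (x'\<^sup>2 * Q g + y'\<^sup>2 * Q h)) x' y'"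
      unfolding \<psi>_def prod.case by (rule span_singleton_eqD)
    then show "x = x' \<and> y = y'"
      by (simp add: comb_scale comb_eq_iff)
  qed
  have notin: "vec.span {f} \<notin> range \<psi>"
  proof
    assume "vec.span {f} \<in> range \<psi>"
    then obtain x y where "\<psi> (x, y) = vec.span {f}"
      by (metis rangeE surj_pair)
    then obtain k where "comb 1 (- (x\<^sup>2 * Q g + y\<^sup>2 * Q h)) x y = k *s f"
      unfolding \<psi>_def prod.case by (rule span_singleton_eqD)
    then show False
      by (simp add: f comb_eq_iff)
  qed
  have "quadric Q = insert (vec.span {f}) (range \<psi>)"
  proof (intro equalityI subsetI)
    fix P assume "P \<in> quadric Q"
    then obtain v where v: "v \<noteq> 0" "P = vec.span {v}" "Q v = 0"
      unfolding in_quadric_iff by blast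
    obtain x0 x1 x2 x3 where x: "v = comb x0 x1 x2 x3"
      by (rule comb_cases)
    show "P \<in> insert (vec.span {f}) (range \<psi>)"
    proof (cases "x0 = 0")
      case True
      \<comment> \<open>On \<open>x0 = 0\<close> the value of Q depends only on \<open>x2\<close>
        and \<open>x3\<close>, so anisotropy kills both and leaves the single point spanned by
        f.\<close>
      have "Q (comb 0 0 x2 x3) = 0"
        using v True by (simp add: x Q_comb)
      then have "comb 0 0 x2 x3 = 0"
        by (intro orthogonal_to_hyperbolic_pair_anisotropic[of e f])
          (simp_all add: Q_e b_e_f b_comb b_commute[of _ "comb _ _ _ _"])
      then have "x2 = 0" "x3 = 0"
        using comb_eq_iff[of 0 0 x2 x3 0 0 0 0] by (simp_all add: comb_zero)
      with True x have "v = x1 *s f"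
        by (simp add: f)
      with v have "P = vec.span {f}"
        by (auto intro!: span_singleton_eqI)
      then show ?thesis
        by simp
    next
      case False
      have "x1 = - ((x2\<^sup>2 * Q g + x3\<^sup>2 * Q h) / x0)"
        using v False by (simp add: x Q_comb field_simps eq_neg_iff_add_eq_0)
      then have "v = x0 *s comb 1 (- ((x2 / x0)\<^sup>2 * Q g + (x3 / x0)\<^sup>2 * Q h)) (x2 / x0) (x3 / x0)"
        using False by (simp add: x comb_scale comb_eq_iff power_divide)
          (simp add: field_simps power2_eq_square)
      then have "P = \<psi> (x2 / x0, x3 / x0)"
        using False v by (auto simp: \<psi>_def intro!: span_singleton_eqI)
      then show ?thesis
        by blast
    qed
  next
    fix P assume "P \<in> insert (vec.span {f}) (range \<psi>)"
    then obtain x0 x1 x2 x3 where x: "P = vec.span {comb x0 x1 x2 x3}"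
        "x0 * x1 + x2\<^sup>2 * Q g + x3\<^sup>2 * Q h = 0" "x0 \<noteq> 0 \<or> x1 \<noteq> 0"
    proof (elim insertE rangeE)
      assume "P = vec.span {f}"
      with that[of 0 1 0 0] show ?thesis
        by (simp flip: f)
    next
      fix z assume "P = \<psi> z"
      with that[of 1 "- ((fst z)\<^sup>2 * Q g + (snd z)\<^sup>2 * Q h)" "fst z" "snd z"] show ?thesis
        by (simp add: \<psi>_def case_prod_beta)
    qed
    then have "comb x0 x1 x2 x3 \<noteq> 0"
      using comb_eq_iff[of x0 x1 x2 x3 0 0 0 0] by (auto simp: comb_zero)
    with x show "P \<in> quadric Q"
      by (auto simp: in_quadric_iff Q_comb)
  qed
  then show ?thesis
    using inj notin by (simp add: card_image power2_eq_square)
qed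

text \<open>On the hyperbolic plane, exchanging the coordinates and scaling one by n multiplies
  \<open>x0 * x1\<close> by n. On the anisotropic plane, with a = Q g and c = Q h, the matrix of
  \<open>T\<close> has trace 0 and determinant - n, so it squares to n by Cayley-Hamilton.\<close>

lemma similarity_exists:
  obtains T n where "nonsquare_operator T n" "\<And>v. Q (T v) = n * Q v"
proof -
  obtain p t where nonsq: "\<And>s. s\<^sup>2 \<noteq> p\<^sup>2 + (Q g * Q h) * t\<^sup>2"
    using nonsquare_value_exists[OF nonsquare_discriminant] by blast
  define n where "n = p\<^sup>2 + (Q g * Q h) * t\<^sup>2"
  \<comment> \<open>By \<open>b_comb\<close>, b v e is the coordinate \<open>x1\<close> and b v f is
    \<open>x0\<close>; the other two need division by 2 * Q g and 2 * Q h.\<close>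
  define T where "T v = (let x2 = b v g / (2 * Q g); x3 = b v h / (2 * Q h) in
    comb (n * b v e) (b v f) (p * x2 + Q h * t * x3) (Q g * t * x2 - p * x3))" for v
  have T_comb: "T (comb x0 x1 x2 x3)
      = comb (n * x1) x0 (p * x2 + Q h * t * x3) (Q g * t * x2 - p * x3)" for x0 x1 x2 x3
    using Q_g Q_h two_neq_0 by (simp add: T_def b_comb)
  have "nonsquare_operator T n"
  proof
    fix v w k
    obtain x0 x1 x2 x3 where v: "v = comb x0 x1 x2 x3"
      by (rule comb_cases)
    obtain y0 y1 y2 y3 where w: "w = comb y0 y1 y2 y3"
      by (rule comb_cases)
    show "T (v + w) = T v + T w"
      by (simp add: v w comb_add T_comb algebra_simps)
    show "T (k *s v) = k *s T v"
      by (simp add: v comb_scale T_comb algebra_simps)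
    show "T (T v) = n *s v"
      by (simp add: v T_comb comb_scale comb_eq_iff)
        (simp add: n_def algebra_simps power2_eq_square)
    show "s\<^sup>2 \<noteq> n" for s
      using nonsq by (simp add: n_def)
  qed
  moreover have "Q (T v) = n * Q v" for v
  proof -
    obtain x0 x1 x2 x3 where v: "v = comb x0 x1 x2 x3"
      by (rule comb_cases)
    \<comment> \<open>The mixed terms in \<open>x2 * x3\<close> cancel because of the opposite signs
      of p, and each square keeps the factor n.\<close>
    have "(p * x2 + Q h * t * x3)\<^sup>2 * Q g + (Q g * t * x2 - p * x3)\<^sup>2 * Q h
        = n * (x2\<^sup>2 * Q g + x3\<^sup>2 * Q h)"
      by (simp add: n_def algebra_simps power2_eq_square)
    then show ?thesis
      by (simp add: v T_comb Q_comb algebra_simps)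
  qed
  ultimately show ?thesis
    using that by blast
qed

end

section \<open>Intersections of spread lines with the quadric\<close>

locale elliptic_form_similarity = elliptic_form Q + nonsquare_operator T n
  for Q :: "'a::{field,finite} ^ 4 \<Rightarrow> 'a" and T :: "'a ^ 4 \<Rightarrow> 'a ^ 4" and n +
  assumes Q_T: "Q (T v) = n * Q v"
begin

text \<open>Both v and T v are singular, so Q (\<alpha> v + \<beta> T v) = \<alpha> \<beta> b v (T
  v). The last factor is nonzero by Witt index 1, so a zero has \<alpha> = 0 or \<beta> = 0.\<close>

lemma points_on_line:
  assumes "v \<noteq> 0" "Q v = 0"
  shows "{P \<in> quadric Q. P \<subseteq> line v} = {vec.span {v}, vec.span {T v}}"
proof (intro equalityI subsetI)
  have "b v (T v) \<noteq> 0"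
    using orthogonal_singular_in_span[of v "T v"] T_notin_span[of v] assms by (auto simp: Q_T)
  fix P assume "P \<in> {P \<in> quadric Q. P \<subseteq> line v}"
  then obtain w where w: "w \<noteq> 0" "P = vec.span {w}" "Q w = 0" "w \<in> line v"
    by (auto simp: in_quadric_iff span_singleton_subset_iff subspace_line)
  then obtain \<alpha> \<beta> where ab: "w = \<alpha> *s v + \<beta> *s T v"
    by (auto simp: line_def in_span_pair_iff)
  with w have "\<alpha> * (\<beta> * b v (T v)) = 0"
    by (auto simp: Q_add Q_scale b_simps Q_T assms)
  with \<open>b v (T v) \<noteq> 0\<close> have "\<alpha> = 0 \<or> \<beta> = 0"
    by simp
  then have "vec.span {w} = vec.span {v} \<or> vec.span {w} = vec.span {T v}"
    using ab w span_singleton_eqI[of w \<alpha> v] span_singleton_eqI[of w \<beta> "T v"] by auto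
  with w show "P \<in> {vec.span {v}, vec.span {T v}}"
    by auto
next
  have "T v \<noteq> 0"
    using T_notin_span[OF assms(1)] vec.span_zero by metis
  fix P assume "P \<in> {vec.span {v}, vec.span {T v}}"
  then obtain w where "P = vec.span {w}" "w \<noteq> 0" "Q w = 0" "w \<in> line v"
    using assms \<open>T v \<noteq> 0\<close> in_line Q_T by auto
  then show "P \<in> {P \<in> quadric Q. P \<subseteq> line v}"
    by (auto simp: in_quadric_iff span_singleton_subset_iff subspace_line)
qed

text \<open>A singular point on L presents L as \<open>line v\<close> with v singular, and
  \<open>T\<close> moves that point. Hence no spread line is tangent to the quadric.\<close>

lemma two_secant_spread_line:
  assumes "L \<in> spread" "P \<in> quadric Q" "P \<subseteq> L"
  shows "two_secant L (quadric Q)"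
proof -
  obtain v where v: "v \<noteq> 0" "P = vec.span {v}" "Q v = 0"
    using assms(2) unfolding in_quadric_iff by blast
  then have "L = line v"
    using assms in_spread_eq_line[of L v] by (auto simp: vec.span_base subset_iff)
  have "vec.span {v} \<noteq> vec.span {T v}"
    using T_notin_span[OF v(1)] vec.span_base[of "T v" "{T v}"] by auto
  then show ?thesis
    using v by (simp add: \<open>L = line v\<close> two_secant_def points_on_line line_in_pg_lines)
qed

text \<open>Every point of the quadric lies on exactly one spread line, which is 2-secant, so these
  lines cut the quadric into disjoint pairs.\<close>

lemma card_quadric_eq: "card (quadric Q) = 2 * card {L \<in> spread. two_secant L (quadric Q)}"
proof -
  let ?S = "{L \<in> spread. two_secant L (quadric Q)}"
  have points: "quadric Q \<subseteq> pg_points"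
    by (auto simp: quadric_def)
  have "quadric Q = (\<Union>L\<in>?S. {P \<in> quadric Q. P \<subseteq> L})"
  proof (intro equalityI subsetI)
    fix P assume P: "P \<in> quadric Q"
    with points obtain L where "L \<in> spread" "P \<subseteq> L"
      using ex1_spread_line[of P] by blast
    with P two_secant_spread_line show "P \<in> (\<Union>L\<in>?S. {P \<in> quadric Q. P \<subseteq> L})"
      by blast
  qed simp
  also have "card \<dots> = (\<Sum>L\<in>?S. card {P \<in> quadric Q. P \<subseteq> L})"
    using ex1_spread_line points by (intro card_UN_disjoint) (simp_all, blast)
  also have "\<dots> = (\<Sum>L\<in>?S. 2)"
    by (intro sum.cong) (auto simp: two_secant_def)
  finally show ?thesis
    by simp
qed

end

section \<open>The spread with half as many 2-secant lines as the quadric has points\<close>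

theorem proposition5p2:
  fixes q :: nat and E :: "('a::{field,finite} ^ 4) set set"
  assumes "primepow q"
    and "(\<exists>h\<ge>1. q = 3 ^ h) \<or> [q = 1] (mod 4)"
    and "CARD('a) = q"
    and "elliptic_quadric E"
  shows "\<exists>S. line_spread S
           \<and> real (card {L \<in> S. two_secant L E}) = real (card E) / 2
           \<and> real (card E) / 2 = ((real q)\<^sup>2 + 1) / 2"
proof -
  \<comment> \<open>Powers of 3 and numbers congruent to 1 modulo 4 are odd; this makes 2 invertible
    in the field.\<close>
  have "odd q"
    using assms(2) by (auto simp: cong_def) presburger
  obtain Q where Q: "quadratic_form Q" "nonsingular_form Q" "witt_index Q = 1" "E = quadric Q"
    using assms(4) by (auto simp: elliptic_quadric_def)
  interpret elliptic_form Q
    using Q two_neq_zero_if_odd_CARD \<open>odd q\<close> assms(3) by unfold_locales auto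
  obtain e f g h where "elliptic_frame Q e f g h"
    by (rule elliptic_frame_exists)
  then interpret elliptic_frame Q e f g h .
  obtain T n where T: "nonsquare_operator T n" "\<And>v. Q (T v) = n * Q v"
    by (rule similarity_exists) blast
  interpret nonsquare_operator T n
    by (rule T)
  interpret elliptic_form_similarity Q T n
    by unfold_locales (rule T)
  have "real (card E) = (real q)\<^sup>2 + 1"
    by (simp add: Q(4) card_quadric assms(3))
  moreover have "real (card {L \<in> spread. two_secant L E}) = real (card E) / 2"
    by (simp add: Q(4) card_quadric_eq)
  ultimately show ?thesis
    using line_spread_spread by metis
qed

end
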